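(* Let $n=2^\ell$ with $\ell\ge 2$ an integer, and consider a knockout tournament with $n$ players of equal strength (i.e. $p_{ij}=1/2$ for all $i\neq j$) in which the schedule of matches is deterministic. Let $S_i$ be the number of games won by player $i\in\{1,\dots,n\}$. Then the random vector $\boldsymbol S=(S_1,\dots,S_n)$ is negatively associated (NA) and, hence, negatively supermodular dependent (NSMD).
   Context: Notation: $[n]=\{1,\dots,n\}$; for $A\subset[n]$, $\boldsymbol X_A=(X_j)_{j\in A}$. "Increasing" is in the weak sense. A random vector $\boldsymbol X=(X_1,\dots,X_n)$ is NA if for every pair of disjoint subsets $A_1,A_2\subset[n]$, ${\rm Cov}(\psi_1(\boldsymbol X_{A_1}),\psi_2(\boldsymbol X_{A_2}))\le 0$ whenever $\psi_1,\psi_2$ are coordinatewise increasing real functions such that the covariance exists. A function $\psi:\mathbb R^n\to\mathbb R$ is supermodular if $\psi(\boldsymbol x\vee\boldsymbol y)+\psi(\boldsymbol x\wedge\boldsymbol y)\ge\psi(\boldsymbol x)+\psi(\boldsymbol y)$ for all $\boldsymbol x,\boldsymbol y\in\mathbb R^n$, where $\vee,\wedge$ denote componentwise maximum and minimum. A random vector $\boldsymbol X$ is NSMD if $\mathbb E[\psi(\boldsymbol X)]\le\mathbb E[\psi(\boldsymbol X^\perp)]$ for every supermodular $\psi$ such that the expectations exist, where $\boldsymbol X^\perp=(X_1^\perp,\dots,X_n^\perp)$ has independent components with $X_i^\perp\stackrel{d}{=}X_i$ for each $i$. Knockout tournament with $n=2^\ell$ players: whenever players $i\ne j$ meet, player $i$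 defeats player $j$ with probability $p_{ij}$ (and $p_{ji}=1-p_{ij}$), independently of all other duels. The winners of one round move to the next round and the defeated players are eliminated; the tournament continues until only one player remains. Deterministic schedule (non-random draw): the bracket is fixed in advance, i.e. the players are placed by a fixed bijection at positions $1,\dots,2^\ell$, and in round $k\in\{1,\dots,\ell\}$, for each $m\in\{1,\dots,2^{\ell-k}\}$, the surviving player among positions $(m-1)2^k+1,\dots,(m-1)2^k+2^{k-1}$ plays against the surviving player among positions $(m-1)2^k+2^{k-1}+1,\dots,m2^k$. *)

theory Defs
  imports "HOL-Probability.Probability"
begin

section \<open>Negative association and negative supermodular dependence\<close>

text \<open>
  A vector indexed by \<open>I\<close> is a function in \<open>I \<rightarrow>\<^sub>E UNIV\<close>, so it takes one fixed value outside \<open>I\<close>.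
  On that set the pointwise order, \<open>sup\<close> and \<open>inf\<close> of functions are therefore the coordinatewise
  order, maximum and minimum. For \<open>A \<subseteq> I\<close> the subvector of \<open>X\<close> with indices in \<open>A\<close> is
  \<open>\<lambda>i\<in>A. X i \<omega>\<close>.
\<close>

definition random_vector :: "'a measure \<Rightarrow> 'i set \<Rightarrow> ('i \<Rightarrow> 'a \<Rightarrow> real) \<Rightarrow> bool" where
  "random_vector M I X \<longleftrightarrow>
     prob_space M \<and> finite I \<and> (\<forall>i\<in>I. X i \<in> borel_measurable M)"

definition covariance :: "'a measure \<Rightarrow> ('a \<Rightarrow> real) \<Rightarrow> ('a \<Rightarrow> real) \<Rightarrow> real" where
  "covariance M f g =
     (\<integral>\<omega>. (f \<omega> - (\<integral>\<omega>. f \<omega> \<partial>M)) * (g \<omega> - (\<integral>\<omega>. g \<omega> \<partial>M)) \<partial>M)"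

definition covariance_exists :: "'a measure \<Rightarrow> ('a \<Rightarrow> real) \<Rightarrow> ('a \<Rightarrow> real) \<Rightarrow> bool" where
  "covariance_exists M f g \<longleftrightarrow>
     integrable M f \<and> integrable M g \<and> integrable M (\<lambda>\<omega>. f \<omega> * g \<omega>)"

text \<open>
  The test functions are not assumed to be Borel: it suffices that their compositions with the
  random vector are measurable, which is part of integrability.
\<close>

definition negatively_associated :: "'a measure \<Rightarrow> 'i set \<Rightarrow> ('i \<Rightarrow> 'a \<Rightarrow> real) \<Rightarrow> bool" where
  "negatively_associated M I X \<longleftrightarrow> random_vector M I X \<and>
     (\<forall>A B \<phi> \<psi>. A \<subseteq> I \<longrightarrow> B \<subseteq> I \<longrightarrow> A \<inter> B = {} \<longrightarrow>
        mono_on (A \<rightarrow>\<^sub>E UNIV) \<phi> \<longrightarrow> mono_on (B \<rightarrow>\<^sub>E UNIV) \<psi> \<longrightarrow>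
        covariance_exists M (\<lambda>\<omega>. \<phi> (\<lambda>i\<in>A. X i \<omega>)) (\<lambda>\<omega>. \<psi> (\<lambda>i\<in>B. X i \<omega>)) \<longrightarrow>
        covariance M (\<lambda>\<omega>. \<phi> (\<lambda>i\<in>A. X i \<omega>)) (\<lambda>\<omega>. \<psi> (\<lambda>i\<in>B. X i \<omega>)) \<le> 0)"

definition supermodular :: "'i set \<Rightarrow> (('i \<Rightarrow> real) \<Rightarrow> real) \<Rightarrow> bool" where
  "supermodular I \<psi> \<longleftrightarrow>
     (\<forall>x \<in> I \<rightarrow>\<^sub>E UNIV. \<forall>y \<in> I \<rightarrow>\<^sub>E UNIV. \<psi> (sup x y) + \<psi> (inf x y) \<ge> \<psi> x + \<psi> y)"

definition independent_version ::
  "'a measure \<Rightarrow> 'b measure \<Rightarrow> 'i set \<Rightarrow> ('i \<Rightarrow> 'a \<Rightarrow> real) \<Rightarrow> ('i \<Rightarrow> 'b \<Rightarrow> real) \<Rightarrow> bool" where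
  "independent_version M N I X Y \<longleftrightarrow>
     random_vector N I Y \<and> prob_space.indep_vars N (\<lambda>_. borel) Y I \<and>
     (\<forall>i\<in>I. distr N borel (Y i) = distr M borel (X i))"

text \<open>
  The independent version ranges over all realisations on sample spaces over the type
  \<open>'i \<Rightarrow> real\<close>, with any sigma-algebra. Fixing this type loses nothing: an independent version
  \<open>Y\<close> on another space can be pushed forward to it along \<open>\<omega> \<mapsto> (\<lambda>i\<in>I. Y i \<omega>)\<close>, using the largest
  sigma-algebra that makes this map measurable, and integrability and expectations of functions
  of \<open>Y\<close> are unchanged.
\<close>

definition NSMD :: "'a measure \<Rightarrow> 'i set \<Rightarrow> ('i \<Rightarrow> 'a \<Rightarrow> real) \<Rightarrow> bool" where
  "NSMD M I X \<longleftrightarrow> random_vector M I X \<and>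
     (\<forall>(N :: ('i \<Rightarrow> real) measure) Y \<psi>. independent_version M N I X Y \<longrightarrow> supermodular I \<psi> \<longrightarrow>
        integrable M (\<lambda>\<omega>. \<psi> (\<lambda>i\<in>I. X i \<omega>)) \<longrightarrow> integrable N (\<lambda>\<omega>. \<psi> (\<lambda>i\<in>I. Y i \<omega>)) \<longrightarrow>
        (\<integral>\<omega>. \<psi> (\<lambda>i\<in>I. X i \<omega>) \<partial>M) \<le> (\<integral>\<omega>. \<psi> (\<lambda>i\<in>I. Y i \<omega>) \<partial>N))"


section \<open>Knockout tournaments with a deterministic schedule\<close>

text \<open>
  \<open>D i j \<omega>\<close> says that player \<open>i\<close> defeats player \<open>j\<close> should they meet. Two players meet at most
  once, so one outcome per unordered pair determines the tournament.
\<close>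

definition duel_outcomes ::
  "'a measure \<Rightarrow> nat \<Rightarrow> (nat \<Rightarrow> nat \<Rightarrow> real) \<Rightarrow> (nat \<Rightarrow> nat \<Rightarrow> 'a \<Rightarrow> bool) \<Rightarrow> bool" where
  "duel_outcomes M n p D \<longleftrightarrow> prob_space M \<and>
     (\<forall>i\<in>{1..n}. \<forall>j\<in>{1..n}. i \<noteq> j \<longrightarrow>
        (\<forall>\<omega>\<in>space M. D j i \<omega> \<longleftrightarrow> \<not> D i j \<omega>) \<and>
        measure M {\<omega>\<in>space M. D i j \<omega>} = p i j) \<and>
     prob_space.indep_vars M (\<lambda>_. count_space UNIV) (\<lambda>(i, j). D i j)
       {(i, j). 1 \<le> i \<and> i < j \<and> j \<le> n}"

text \<open>
  For a schedule \<open>\<sigma>\<close>, which maps positions to players, and a relation \<open>beats\<close>,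
  \<open>survivor \<sigma> beats k m\<close> is the player surviving \<open>k\<close> rounds among the positions
  \<open>(m - 1) * 2 ^ k + 1, \<dots>, m * 2 ^ k\<close>. For \<open>k \<ge> 1\<close> it is the winner of the \<open>m\<close>-th match of
  round \<open>k\<close>. All positions are numbered from 1.
\<close>

fun survivor :: "(nat \<Rightarrow> nat) \<Rightarrow> (nat \<Rightarrow> nat \<Rightarrow> bool) \<Rightarrow> nat \<Rightarrow> nat \<Rightarrow> nat" where
  "survivor \<sigma> beats 0 m = \<sigma> m"
| "survivor \<sigma> beats (Suc k) m =
     (let i = survivor \<sigma> beats k (2 * m - 1); j = survivor \<sigma> beats k (2 * m)
      in if beats i j then i else j)"

definition games_won :: "nat \<Rightarrow> (nat \<Rightarrow> nat) \<Rightarrow> (nat \<Rightarrow> nat \<Rightarrow> bool) \<Rightarrow> nat \<Rightarrow> nat" where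
  "games_won l \<sigma> beats i =
     card {(k, m). k \<in> {1..l} \<and> m \<in> {1..2 ^ (l - k)} \<and> survivor \<sigma> beats k m = i}"

end

theory Submission
  imports Defs
begin

text \<open>
  Number the matches of the bracket by round and place, and toss one fair coin for each match: the
  coin decides which of the two rivals wins. Since a pair of players can meet in one match only,
  and the duels are independent and fair, the outcomes of the matches that are actually played are distributed as independent fair coins (\<open>coins_uniform\<close>). The scores of the
  positions are a function \<open>score\<close> of the coins.

  Negative association of the scores is proved by induction on the number of rounds
  (\<open>score_negatively_associated\<close>), conditioning on the first round. In each first-round match the
  winner obtains one plus the score that the match's slot obtains in the remaining tournament of
  half the size, and the loser obtains zero. The remaining tournament is independent of the first
  round because all players are equally strong.
  Given the first round, increasing functions of disjoint sets of scores are increasing functions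
  of disjoint sets of slot scores, so by induction their conditional covariance is at most zero.
  It remains to compare the two conditional expectations, which are functions of the first-round
  coins. Take one coin. If one of the two functions involves neither rival, then its conditional
  expectation does not depend on this coin. Otherwise the two functions involve one rival each, and
  one conditional expectation increases while the other decreases in the coin. Functions of independent coins which are
  opposite in every coin in this sense have nonpositive covariance (\<open>avg_Pow_opposite\<close>), by
  induction on the number of coins as in Chebyshev's and Harris' inequalities.

  Negative association implies negative supermodular dependence for vectors with values in
  \<open>{0, \<dots>, l}\<close> by replacing the components one at a time by independent copies. Writing
  \<open>\<psi>(x\<^sub>1, r) = \<psi>(0, r) + \<Sum>\<^sub>t 1[x\<^sub>1 \<ge> t + 1] (\<psi>(t + 1, r) - \<psi>(t, r))\<close>, supermodularity says that the
  increments are increasing in \<open>r\<close>, so negative association bounds the expectation of each summand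
  by the product of the expectations (\<open>supermodular_decouple_one\<close>).
\<close>

section \<open>Averages over finite sets\<close>

text \<open>
  The mean of \<open>f\<close> under the uniform distribution on the finite set \<open>W\<close>. A family of independent
  fair coins with index set \<open>K\<close> is a uniformly distributed element of \<open>Pow K\<close>, namely the set of
  the coins that show heads.
\<close>

definition avg :: "'a set \<Rightarrow> ('a \<Rightarrow> real) \<Rightarrow> real" where
  "avg W f = (\<Sum>w\<in>W. f w) / real (card W)"

lemma avg_cong: "(\<And>w. w \<in> W \<Longrightarrow> f w = g w) \<Longrightarrow> avg W f = avg W g"
  unfolding avg_def by (metis sum.cong)

lemma avg_mono: "(\<And>w. w \<in> W \<Longrightarrow> f w \<le> g w) \<Longrightarrow> avg W f \<le> avg W g"
  unfolding avg_def by (intro divide_right_mono sum_mono) auto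

lemma avg_diff: "avg W (\<lambda>w. f w - g w) = avg W f - avg W g"
  unfolding avg_def by (simp add: sum_subtractf diff_divide_distrib)

lemma avg_mult_left: "avg W (\<lambda>w. a * f w) = a * avg W f"
  unfolding avg_def by (simp add: sum_distrib_left)

lemma avg_mult_right: "avg W (\<lambda>w. f w * a) = avg W f * a"
  unfolding avg_def by (simp add: sum_distrib_right)

lemma avg_Pow_insert:
  assumes "finite K" "k \<notin> K"
  shows "avg (Pow (insert k K)) f = (avg (Pow K) f + avg (Pow K) (\<lambda>b. f (insert k b))) / 2"
proof -
  have inj: "inj_on (insert k) (Pow K)"
    using assms(2) by (auto simp: inj_on_def)
  have "sum f (Pow (insert k K)) = sum f (Pow K) + sum f (insert k ` Pow K)"
    unfolding Pow_insert using assms by (intro sum.union_disjoint) auto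
  also have "sum f (insert k ` Pow K) = (\<Sum>b\<in>Pow K. f (insert k b))"
    by (simp add: sum.reindex[OF inj])
  finally show ?thesis
    using assms by (simp add: avg_def card_Pow field_simps)
qed

lemma avg_Pow_Un:
  assumes "finite A" "finite B" "A \<inter> B = {}"
  shows "avg (Pow (A \<union> B)) f = avg (Pow A) (\<lambda>a. avg (Pow B) (\<lambda>b. f (a \<union> b)))"
  using assms
proof (induction A arbitrary: f rule: finite_induct)
  case empty
  show ?case by (simp add: avg_def)
next
  case (insert x A)
  have "avg (Pow (insert x A \<union> B)) f
      = (avg (Pow (A \<union> B)) f + avg (Pow (A \<union> B)) (\<lambda>c. f (insert x c))) / 2"
    using insert.hyps insert.prems by (simp add: avg_Pow_insert)
  then show ?case
    using insert.hyps insert.prems by (simp add: insert.IH avg_Pow_insert)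
qed

lemma avg_Pow_image:
  assumes "inj_on h A"
  shows "avg (Pow (h ` A)) f = avg (Pow A) (\<lambda>a. f (h ` a))"
proof -
  have inj: "inj_on (image h) (Pow A)"
    by (rule inj_on_image_Pow[OF assms])
  have "Pow (h ` A) = image h ` Pow A"
    by (simp add: image_Pow_surj)
  then show ?thesis
    using inj by (simp add: avg_def sum.reindex card_image o_def)
qed

text \<open>
  The hypothesis says that \<open>u\<close> and \<open>v\<close> respond to each coin in opposite directions, where a function
  that ignores the coin counts as opposite to any function. The configurations \<open>b\<close> and \<open>b'\<close> of the
  other coins may differ, so each direction is the same for all configurations.
\<close>

lemma avg_Pow_opposite:
  assumes "finite K"
    and "\<And>k b b'. \<lbrakk>k \<in> K; b \<subseteq> K - {k}; b' \<subseteq> K - {k}\<rbrakk>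
           \<Longrightarrow> (u (insert k b) - u b) * (v (insert k b') - v b') \<le> 0"
  shows "avg (Pow K) (\<lambda>b. u b * v b) \<le> avg (Pow K) u * avg (Pow K) v"
  using assms
proof (induction K arbitrary: u v rule: finite_induct)
  case empty
  show ?case by (simp add: avg_def)
next
  case (insert k K)
  define u0 v0 u1 v1 where "u0 = avg (Pow K) u" and "v0 = avg (Pow K) v"
    and "u1 = avg (Pow K) (\<lambda>b. u (insert k b))" and "v1 = avg (Pow K) (\<lambda>b. v (insert k b))"
  have 0: "avg (Pow K) (\<lambda>b. u b * v b) \<le> u0 * v0"
    unfolding u0_def v0_def using insert.hyps by (intro insert.IH insert.prems) auto
  have 1: "avg (Pow K) (\<lambda>b. u (insert k b) * v (insert k b)) \<le> u1 * v1"
    unfolding u1_def v1_def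
  proof (rule insert.IH)
    fix j b b' assume *: "j \<in> K" "b \<subseteq> K - {j}" "b' \<subseteq> K - {j}"
    then have "(u (insert j (insert k b)) - u (insert k b))
        * (v (insert j (insert k b')) - v (insert k b')) \<le> 0"
      using insert.hyps by (intro insert.prems) auto
    then show "(u (insert k (insert j b)) - u (insert k b))
        * (v (insert k (insert j b')) - v (insert k b')) \<le> 0"
      by (simp add: insert_commute)
  qed
  \<comment> \<open>The averages over the other coins are opposite in the coin \<open>k\<close>.\<close>
  have "(u1 - u0) * (v1 - v0) = avg (Pow K) (\<lambda>b. avg (Pow K)
          (\<lambda>b'. (u (insert k b) - u b) * (v (insert k b') - v b')))"
    by (simp add: u0_def u1_def v0_def v1_def avg_mult_left avg_mult_right avg_diff)
  also have "\<dots> \<le> avg (Pow K) (\<lambda>b. avg (Pow K) (\<lambda>b'. 0))"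
    using insert.hyps by (intro avg_mono insert.prems) auto
  also have "\<dots> = 0" by (simp add: avg_def)
  finally have 2: "(u1 - u0) * (v1 - v0) \<le> 0" .
  have "(u0 * v0 + u1 * v1) / 2 \<le> (u0 + u1) / 2 * ((v0 + v1) / 2)"
    using 2 by (simp add: field_simps)
  then show ?case
    using 0 1 insert.hyps by (simp add: avg_Pow_insert u0_def v0_def u1_def v1_def)
qed

section \<open>Scores as functions of independent coins\<close>

text \<open>
  The pair \<open>(k, m)\<close> is the \<open>m\<close>-th match of round \<open>k\<close>. A set \<open>c \<subseteq> matches l\<close> of coins consists of
  the matches won by the rival from the lower-numbered positions.
\<close>

definition matches :: "nat \<Rightarrow> (nat \<times> nat) set" where
  "matches l = {(k, m). k \<in> {1..l} \<and> m \<in> {1..2 ^ (l - k)}}"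

text \<open>
  The effect of one round on the scores: position \<open>i\<close> plays match \<open>Suc i div 2\<close>, in which the odd
  position \<open>2 * m - 1\<close> meets the even position \<open>2 * m\<close>, and the odd position wins if and only if
  \<open>m \<in> b\<close>. The vector \<open>x\<close> contains the scores which the winners of the matches obtain afterwards.
\<close>

definition advance :: "nat set \<Rightarrow> (nat \<Rightarrow> real) \<Rightarrow> nat \<Rightarrow> real" where
  "advance b x i = (if odd i = (Suc i div 2 \<in> b) then 1 + x (Suc i div 2) else 0)"

text \<open>
  The coins of the tournament that starts with the second round, with the rounds renumbered from 1.
\<close>

definition later_rounds :: "(nat \<times> nat) set \<Rightarrow> (nat \<times> nat) set" where
  "later_rounds c = {(k, m). 1 \<le> k \<and> (Suc k, m) \<in> c}"

text \<open>
  The number of games won by the player at each position, as a function of the coins. The recursion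
  removes the first round, not the final.
\<close>

fun score :: "nat \<Rightarrow> (nat \<times> nat) set \<Rightarrow> nat \<Rightarrow> real" where
  "score 0 c = (\<lambda>i. 0)"
| "score (Suc l) c = advance {m. (1, m) \<in> c} (score l (later_rounds c))"

text \<open>
  The function \<open>f\<close> is increasing and depends on the coordinates in \<open>A\<close> only: taking vectors that
  agree on \<open>A\<close>, the condition yields both inequalities.
\<close>

definition mono_in :: "'i set \<Rightarrow> (('i \<Rightarrow> real) \<Rightarrow> real) \<Rightarrow> bool" where
  "mono_in A f \<longleftrightarrow> (\<forall>x y. (\<forall>i\<in>A. x i \<le> y i) \<longrightarrow> f x \<le> f y)"

lemma finite_matches: "finite (matches l)"
proof -
  have "matches l = (SIGMA k:{1..l}. {1..2 ^ (l - k)})"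
    by (auto simp: matches_def)
  then show ?thesis by simp
qed

lemma matches_0: "matches 0 = {}"
  by (auto simp: matches_def)

lemma matches_Suc:
  "matches (Suc l) = Pair 1 ` {1..2 ^ l} \<union> map_prod Suc id ` matches l"
proof (intro set_eqI iffI)
  fix e assume "e \<in> matches (Suc l)"
  then obtain k m where e: "e = (Suc k, m)" "k \<le> l" "m \<in> {1..2 ^ (l - k)}"
    by (auto simp: matches_def Suc_le_eq gr0_conv_Suc)
  show "e \<in> Pair 1 ` {1..2 ^ l} \<union> map_prod Suc id ` matches l"
  proof (cases "k = 0")
    case False
    with e have "(k, m) \<in> matches l" by (auto simp: matches_def)
    with e(1) show ?thesis by force
  qed (use e in auto)
qed (auto simp: matches_def)

lemma matches_cases:
  assumes "e \<in> matches l"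
  obtains k m where "e = (Suc k, m)" "Suc k \<le> l" "m \<in> {1..2 ^ (l - Suc k)}"
  using assms by (auto simp: matches_def Suc_le_eq gr0_conv_Suc)

lemma rivals_in_range:
  assumes "Suc k \<le> l" "m \<in> {1..2 ^ (l - Suc k)}"
  shows "k \<le> l" "2 * m - 1 \<in> {1..2 ^ (l - k)}" "2 * m \<in> {1..2 ^ (l - k)}" "(Suc k, m) \<in> matches l"
proof -
  have "(2::nat) ^ (l - k) = 2 * 2 ^ (l - Suc k)"
    using assms(1) by (simp add: Suc_diff_Suc flip: power_Suc)
  with assms show "k \<le> l" "2 * m - 1 \<in> {1..2 ^ (l - k)}" "2 * m \<in> {1..2 ^ (l - k)}"
    "(Suc k, m) \<in> matches l"
    by (auto simp: matches_def)
qed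

lemma score_nonneg: "score l c i \<ge> 0"
  by (induction l arbitrary: c i) (auto simp: advance_def)

lemma score_Suc_Un:
  assumes "c \<subseteq> matches l"
  shows "score (Suc l) (Pair 1 ` b \<union> map_prod Suc id ` c) = advance b (score l c)"
proof -
  have "{m. (1, m) \<in> Pair 1 ` b \<union> map_prod Suc id ` c} = b"
    using assms by (auto simp: matches_def)
  moreover have "later_rounds (Pair 1 ` b \<union> map_prod Suc id ` c) = c"
  proof (intro set_eqI iffI)
    fix e assume "e \<in> c"
    moreover from this have "1 \<le> fst e" using assms by (auto simp: matches_def)
    ultimately show "e \<in> later_rounds (Pair 1 ` b \<union> map_prod Suc id ` c)"
      by (cases e) (force simp: later_rounds_def)
  qed (auto simp: later_rounds_def)
  ultimately show ?thesis by simp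
qed

text \<open>
  The coins of the first round are independent of those of the later rounds.
\<close>

lemma avg_matches_Suc:
  "avg (Pow (matches (Suc l))) (\<lambda>c. f (score (Suc l) c))
     = avg (Pow {1..2 ^ l}) (\<lambda>b. avg (Pow (matches l)) (\<lambda>c. f (advance b (score l c))))"
proof -
  have inj: "inj_on (Pair (1::nat)) {1..2 ^ l :: nat}" "inj_on (map_prod Suc id) (matches l)"
    by (auto simp: inj_on_def)
  have "Pair (1::nat) ` {1..2 ^ l} \<inter> map_prod Suc id ` matches l = {}"
    by (auto simp: matches_def)
  then have "avg (Pow (matches (Suc l))) (\<lambda>c. f (score (Suc l) c)) =
     avg (Pow {1..2 ^ l}) (\<lambda>b. avg (Pow (matches l))
       (\<lambda>c. f (score (Suc l) (Pair 1 ` b \<union> map_prod Suc id ` c))))"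
    using finite_matches[of l] inj
    by (simp only: matches_Suc avg_Pow_Un avg_Pow_image finite_imageI finite_atLeastAtMost)
  also have "\<dots> = avg (Pow {1..2 ^ l})
      (\<lambda>b. avg (Pow (matches l)) (\<lambda>c. f (advance b (score l c))))"
    by (intro avg_cong) (simp only: score_Suc_Un Pow_iff)
  finally show ?thesis .
qed

section \<open>Negative association of the scores\<close>

lemma advance_insert_mono:
  assumes f: "mono_in A f" and "\<And>i. 0 \<le> x i" "k \<notin> b"
    and odd: "\<And>i. i \<in> A \<Longrightarrow> Suc i div 2 = k \<Longrightarrow> odd i"
  shows "f (advance b x) \<le> f (advance (insert k b) x)"
proof -
  have "advance b x i \<le> advance (insert k b) x i" if "i \<in> A" for i
  proof (cases "Suc i div 2 = k")
    case True
    with that have "odd i" by (rule odd)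
    with True assms(2,3) show ?thesis by (simp add: advance_def)
  qed (simp add: advance_def)
  with f show ?thesis by (simp add: mono_in_def)
qed

lemma advance_insert_antimono:
  assumes f: "mono_in A f" and "\<And>i. 0 \<le> x i" "k \<notin> b"
    and even: "\<And>i. i \<in> A \<Longrightarrow> Suc i div 2 = k \<Longrightarrow> even i"
  shows "f (advance (insert k b) x) \<le> f (advance b x)"
proof -
  have "advance (insert k b) x i \<le> advance b x i" if "i \<in> A" for i
  proof (cases "Suc i div 2 = k")
    case True
    with that have "even i" by (rule even)
    with True assms(2,3) show ?thesis by (simp add: advance_def)
  qed (simp add: advance_def)
  with f show ?thesis by (simp add: mono_in_def)
qed

text \<open>
  Given the first round, a function of the scores of \<open>A\<close> depends only on the slots of those matches
  that are won by a position in \<open>A\<close>.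
\<close>

lemma mono_in_advance:
  assumes "mono_in A f"
  shows "mono_in ((\<lambda>i. Suc i div 2) ` {i\<in>A. odd i = (Suc i div 2 \<in> b)}) (\<lambda>x. f (advance b x))"
  unfolding mono_in_def
proof (intro allI impI)
  fix x y :: "nat \<Rightarrow> real"
  assume le: "\<forall>j\<in>(\<lambda>i. Suc i div 2) ` {i\<in>A. odd i = (Suc i div 2 \<in> b)}. x j \<le> y j"
  have "advance b x i \<le> advance b y i" if "i \<in> A" for i
  proof (cases "odd i = (Suc i div 2 \<in> b)")
    case True
    with that le have "x (Suc i div 2) \<le> y (Suc i div 2)" by blast
    with True show ?thesis by (simp only: advance_def if_True) simp
  qed (simp only: advance_def if_False order_refl)
  with assms show "f (advance b x) \<le> f (advance b y)" by (simp add: mono_in_def)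
qed

lemma same_match_cases: "Suc i div 2 = Suc j div 2 \<Longrightarrow> odd i = odd j \<Longrightarrow> i = (j::nat)"
  by (cases "odd i") (auto elim!: oddE evenE)

lemma score_negatively_associated:
  fixes A B :: "nat set"
  assumes "A \<inter> B = {}" "mono_in A f" "mono_in B g"
  shows "avg (Pow (matches l)) (\<lambda>c. f (score l c) * g (score l c))
           \<le> avg (Pow (matches l)) (\<lambda>c. f (score l c)) * avg (Pow (matches l)) (\<lambda>c. g (score l c))"
  using assms
proof (induction l arbitrary: A B f g)
  case 0
  show ?case by (simp add: matches_0 avg_def)
next
  case (Suc l)
  let ?K = "{1..2 ^ l :: nat}" and ?W = "Pow (matches l)"
  define u where "u b = avg ?W (\<lambda>c. f (advance b (score l c)))" for b
  define v where "v b = avg ?W (\<lambda>c. g (advance b (score l c)))" for b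
  \<comment> \<open>Given the first round, the induction hypothesis applies, since distinct winners play distinct
    matches.\<close>
  have cond: "avg ?W (\<lambda>c. f (advance b (score l c)) * g (advance b (score l c))) \<le> u b * v b" for b
  proof -
    have "(\<lambda>i. Suc i div 2) ` {i\<in>A. odd i = (Suc i div 2 \<in> b)} \<inter>
        (\<lambda>i. Suc i div 2) ` {i\<in>B. odd i = (Suc i div 2 \<in> b)} = {}"
    proof -
      have "i = j" if "odd i = (Suc i div 2 \<in> b)" "odd j = (Suc j div 2 \<in> b)"
          "Suc i div 2 = Suc j div 2" for i j :: nat
        using that same_match_cases[of i j] by simp
      with Suc.prems(1) show ?thesis by blast
    qed
    from Suc.IH[OF this mono_in_advance[OF Suc.prems(2)] mono_in_advance[OF Suc.prems(3)]]
    show ?thesis by (simp only: u_def v_def)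
  qed
  have opp: "(u (insert k b) - u b) * (v (insert k b') - v b') \<le> 0"
    if "k \<in> ?K" "b \<subseteq> ?K - {k}" "b' \<subseteq> ?K - {k}" for k b b'
  proof -
    have nin: "k \<notin> b" "k \<notin> b'" using that by auto
    \<comment> \<open>The positions \<open>2 * k - 1\<close> and \<open>2 * k\<close> are the only ones that the coin \<open>k\<close> affects, and no
      position is in both sets.\<close>
    let ?odd = "\<lambda>A. \<forall>i\<in>A. Suc i div 2 = k \<longrightarrow> odd i"
    let ?even = "\<lambda>A. \<forall>i\<in>A. Suc i div 2 = k \<longrightarrow> even i"
    have u1: "u b \<le> u (insert k b)" if "?odd A"
      unfolding u_def
      by (rule avg_mono, rule advance_insert_mono[OF Suc.prems(2)]) (use that nin score_nonneg in blast)+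
    have u2: "u (insert k b) \<le> u b" if "?even A"
      unfolding u_def
      by (rule avg_mono, rule advance_insert_antimono[OF Suc.prems(2)]) (use that nin score_nonneg in blast)+
    have v1: "v b' \<le> v (insert k b')" if "?odd B"
      unfolding v_def
      by (rule avg_mono, rule advance_insert_mono[OF Suc.prems(3)]) (use that nin score_nonneg in blast)+
    have v2: "v (insert k b') \<le> v b'" if "?even B"
      unfolding v_def
      by (rule avg_mono, rule advance_insert_antimono[OF Suc.prems(3)]) (use that nin score_nonneg in blast)+
    have uniq: False if "i \<in> A" "j \<in> B" "Suc i div 2 = k" "Suc j div 2 = k" "odd i = odd j" for i j
      using that Suc.prems(1) same_match_cases[of i j] by auto
    have "?even B" if "\<not> ?even A" using that uniq by blast
    moreover have "?odd B" if "\<not> ?odd A" using that uniq by blast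
    ultimately consider "?odd A" "?even B" | "?even A" "?odd B" | "?odd A" "?even A" | "?odd B" "?even B"
      by argo
    then show ?thesis
    proof cases
      case 1
      show ?thesis using u1[OF 1(1)] v2[OF 1(2)] by (simp add: mult_nonneg_nonpos)
    next
      case 2
      show ?thesis using u2[OF 2(1)] v1[OF 2(2)] by (simp add: mult_nonpos_nonneg)
    next
      case 3
      show ?thesis using u1[OF 3(1)] u2[OF 3(2)] by simp
    next
      case 4
      show ?thesis using v1[OF 4(1)] v2[OF 4(2)] by simp
    qed
  qed
  have "avg (Pow (matches (Suc l))) (\<lambda>c. f (score (Suc l) c) * g (score (Suc l) c))
      = avg (Pow ?K) (\<lambda>b. avg ?W (\<lambda>c. f (advance b (score l c)) * g (advance b (score l c))))"
    by (rule avg_matches_Suc[of l "\<lambda>x. f x * g x"])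
  also have "\<dots> \<le> avg (Pow ?K) (\<lambda>b. u b * v b)"
    by (intro avg_mono cond)
  also have "\<dots> \<le> avg (Pow ?K) u * avg (Pow ?K) v"
    using opp by (intro avg_Pow_opposite) auto
  also have "avg (Pow ?K) u = avg (Pow (matches (Suc l))) (\<lambda>c. f (score (Suc l) c))"
    unfolding u_def by (rule avg_matches_Suc[symmetric])
  also have "avg (Pow ?K) v = avg (Pow (matches (Suc l))) (\<lambda>c. g (score (Suc l) c))"
    unfolding v_def by (rule avg_matches_Suc[symmetric])
  finally show ?case .
qed

section \<open>The bracket in terms of coins\<close>

text \<open>
  The position whose player survives \<open>k\<close> rounds in the \<open>m\<close>-th block of \<open>2 ^ k\<close> positions, as a
  function of the coins.
\<close>

fun champ :: "(nat \<times> nat) set \<Rightarrow> nat \<Rightarrow> nat \<Rightarrow> nat" where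
  "champ c 0 m = m"
| "champ c (Suc k) m = (if (Suc k, m) \<in> c then champ c k (2 * m - 1) else champ c k (2 * m))"

lemma champ_block:
  assumes "m \<ge> 1"
  shows "champ c k m \<ge> 1 \<and> (champ c k m - 1) div 2 ^ k = m - 1"
  using assms
proof (induction k arbitrary: m)
  case (Suc k)
  obtain m' where m': "m' = 2 * m - 1 \<or> m' = 2 * m" "champ c (Suc k) m = champ c k m'"
    by (cases "(Suc k, m) \<in> c") auto
  with Suc.prems have "m' \<ge> 1" and half: "(m' - 1) div 2 = m - 1" by auto
  from Suc.IH[OF this(1)]
  have ge: "champ c k m' \<ge> 1" and "(champ c k m' - 1) div 2 ^ k = m' - 1" by auto
  then have "(champ c k m' - 1) div (2 ^ k * 2) = m - 1"
    using half by (simp only: div_mult2_eq)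
  with ge m'(2) show ?case by (simp add: mult.commute)
qed simp

lemma champ_in_range:
  assumes "k \<le> l" "m \<in> {1..2 ^ (l - k)}"
  shows "champ c k m \<in> {1..2 ^ l}"
proof -
  have *: "champ c k m \<ge> 1" "(champ c k m - 1) div 2 ^ k = m - 1"
    using champ_block[of m c k] assms by auto
  have "(champ c k m - 1) div 2 ^ k < 2 ^ (l - k)"
    using * assms by auto
  then have "champ c k m - 1 < 2 ^ (l - k) * 2 ^ k"
    by (simp add: div_less_iff_less_mult)
  also have "(2::nat) ^ (l - k) * 2 ^ k = 2 ^ l"
    using assms by (simp flip: power_add)
  finally show ?thesis using * by auto
qed

text \<open>
  The recursion of \<open>champ\<close> splits off the last round; this equation splits off the first one, to match
  the recursion of \<open>score\<close>.
\<close>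

lemma champ_Suc_later:
  "champ c (Suc k) m = (let w = champ (later_rounds c) k m in if (1, w) \<in> c then 2 * w - 1 else 2 * w)"
proof (induction k arbitrary: m)
  case (Suc k)
  have "champ c (Suc (Suc k)) m
      = (if (Suc (Suc k), m) \<in> c then champ c (Suc k) (2 * m - 1) else champ c (Suc k) (2 * m))"
    by (rule champ.simps)
  then show ?case
    unfolding Suc.IH by (simp add: later_rounds_def)
qed simp

lemma champ_Suc_eq_iff:
  assumes "m \<ge> 1"
  shows "champ c (Suc k) m = i \<longleftrightarrow>
    odd i = ((1, Suc i div 2) \<in> c) \<and> champ (later_rounds c) k m = Suc i div 2"
proof -
  define w where "w = champ (later_rounds c) k m"
  have "w \<ge> 1" unfolding w_def using champ_block[OF assms] by blast
  have left: "2 * w - 1 = i \<longleftrightarrow> odd i \<and> w = Suc i div 2"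
    using \<open>w \<ge> 1\<close> by presburger
  have right: "2 * w = i \<longleftrightarrow> even i \<and> w = Suc i div 2"
    by presburger
  have "champ c (Suc k) m = (if (1, w) \<in> c then 2 * w - 1 else 2 * w)"
    unfolding champ_Suc_later w_def Let_def ..
  then show ?thesis
    unfolding w_def[symmetric] using left right by (cases "(1, w) \<in> c") auto
qed

lemma card_champ_eq_score:
  assumes "i \<in> {1..2 ^ l}"
  shows "real (card {e \<in> matches l. champ c (fst e) (snd e) = i}) = score l c i"
  using assms
proof (induction l arbitrary: c i)
  case 0
  show ?case by (simp add: matches_0)
next
  case (Suc l)
  let ?j = "Suc i div 2"
  let ?W = "{e \<in> matches l. champ (later_rounds c) (fst e) (snd e) = ?j}"
  have j: "?j \<in> {1..2 ^ l}" using Suc.prems by auto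
  have eq: "{e \<in> matches (Suc l). champ c (fst e) (snd e) = i} =
      Pair 1 ` {m \<in> {1..2 ^ l}. champ c (Suc 0) m = i} \<union>
      map_prod Suc id ` {e \<in> matches l. champ c (Suc (fst e)) (snd e) = i}"
    unfolding matches_Suc by auto
  have ge: "snd e \<ge> 1" if "e \<in> matches l" for e
    using that by (auto simp: matches_def)
  show ?case
  proof (cases "odd i = ((1, ?j) \<in> c)")
    case True
    have "champ c (Suc 0) m = i \<longleftrightarrow> m = ?j" if "m \<ge> 1" for m
      using champ_Suc_eq_iff[OF that, of c 0 i] True unfolding champ.simps(1) by blast
    then have 1: "{m \<in> {1..2 ^ l}. champ c (Suc 0) m = i} = {?j}"
      using j by force
    have 2: "{e \<in> matches l. champ c (Suc (fst e)) (snd e) = i} = ?W"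
      using champ_Suc_eq_iff[OF ge] True by blast
    have "card {e \<in> matches (Suc l). champ c (fst e) (snd e) = i}
        = card (Pair (1::nat) ` {?j}) + card (map_prod Suc id ` ?W)"
      unfolding eq 1 2
    proof (rule card_Un_disjoint)
      show "finite (map_prod Suc id ` ?W)" using finite_matches[of l] by simp
      have "fst e \<ge> 1" if "e \<in> ?W" for e using that by (simp add: matches_def split_beta)
      then show "Pair 1 ` {?j} \<inter> map_prod Suc id ` ?W = {}" by fastforce
    qed simp
    also have "card (map_prod Suc (id :: nat \<Rightarrow> nat) ` ?W) = card ?W"
      by (intro card_image) (auto simp: inj_on_def)
    finally have "card {e \<in> matches (Suc l). champ c (fst e) (snd e) = i} = 1 + card ?W"
      by simp
    moreover have "score (Suc l) c i = 1 + score l (later_rounds c) ?j"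
      by (simp only: score.simps advance_def mem_Collect_eq if_P[OF True])
    ultimately show ?thesis
      using Suc.IH[OF j, of "later_rounds c"] by simp
  next
    case False
    have "champ c (Suc 0) m \<noteq> i" if "m \<ge> 1" for m
      using champ_Suc_eq_iff[OF that, of c 0 i] False by blast
    then have 1: "{m \<in> {1..2 ^ l}. champ c (Suc 0) m = i} = {}"
      by force
    have 2: "{e \<in> matches l. champ c (Suc (fst e)) (snd e) = i} = {}"
      using champ_Suc_eq_iff[OF ge] False by blast
    have "score (Suc l) c i = 0"
      by (simp only: score.simps advance_def mem_Collect_eq if_not_P[OF False])
    then show ?thesis unfolding eq 1 2 by simp
  qed
qed

lemma div_power_eq_mono:
  fixes x y :: nat
  assumes "x div 2 ^ k = y div 2 ^ k" "k \<le> k'"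
  shows "x div 2 ^ k' = y div 2 ^ k'"
proof -
  have "(2::nat) ^ k' = 2 ^ k * 2 ^ (k' - k)"
    using assms(2) by (simp flip: power_add)
  then show ?thesis using assms(1) by (simp add: div_mult2_eq)
qed

text \<open>
  Two positions lie in a common block of round \<open>j\<close> if and only if \<open>j\<close> is at least the round of their
  potential match. Here \<open>x\<close>, \<open>y\<close> and \<open>x'\<close>, \<open>y'\<close> are positions counted from 0, and the two matches
  are in the rounds \<open>Suc k\<close> and \<open>Suc k'\<close>.
\<close>

lemma meeting_determines_round:
  fixes x y x' y' :: nat
  assumes "m \<ge> 1" "m' \<ge> 1" "{x, y} = {x', y'}"
    and "x div 2 ^ k = 2 * m - 2" "y div 2 ^ k = 2 * m - 1"
    and "x' div 2 ^ k' = 2 * m' - 2" "y' div 2 ^ k' = 2 * m' - 1"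
  shows "k' \<le> k"
proof (rule ccontr)
  assume "\<not> k' \<le> k"
  then have le: "Suc k \<le> k'" by simp
  have "(2 * m - 2) div 2 = (2 * m - 1) div 2"
    using assms(1) by presburger
  then have "x div 2 ^ k div 2 = y div 2 ^ k div 2"
    by (simp only: assms(4,5))
  then have "x div (2 ^ k * 2) = y div (2 ^ k * 2)"
    by (simp only: div_mult2_eq)
  then have "x div 2 ^ Suc k = y div 2 ^ Suc k"
    by (simp only: power_Suc2)
  from div_power_eq_mono[OF this le] have "x' div 2 ^ k' = y' div 2 ^ k'"
    using assms(3) by (auto simp: doubleton_eq_iff)
  with assms(2,6,7) show False by simp
qed

lemma meeting_determines_match:
  fixes x y x' y' :: nat
  assumes "m \<ge> 1" "m' \<ge> 1" "{x, y} = {x', y'}"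
    and "x div 2 ^ k = 2 * m - 2" "y div 2 ^ k = 2 * m - 1"
    and "x' div 2 ^ k' = 2 * m' - 2" "y' div 2 ^ k' = 2 * m' - 1"
  shows "k = k' \<and> m = m'"
proof -
  have k: "k = k'"
    using meeting_determines_round[OF assms]
      meeting_determines_round[OF assms(2,1) assms(3)[symmetric] assms(6,7,4,5)] by simp
  from assms(3) have "x = x' \<and> y = y' \<or> x = y' \<and> y = x'"
    by (auto simp: doubleton_eq_iff)
  then have "m = m'"
    using assms(1,2,4-7) k by auto
  with k show ?thesis by simp
qed

section \<open>Uniformity of the coins\<close>

text \<open>
  The coins realised by the relation \<open>beats\<close>: the matches of the actual tournament that are won by
  the first-named rival.
\<close>

definition coins :: "nat \<Rightarrow> (nat \<Rightarrow> nat) \<Rightarrow> (nat \<Rightarrow> nat \<Rightarrow> bool) \<Rightarrow> (nat \<times> nat) set" where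
  "coins l \<sigma> beats = {(k, m) \<in> matches l.
     beats (survivor \<sigma> beats (k - 1) (2 * m - 1)) (survivor \<sigma> beats (k - 1) (2 * m))}"

text \<open>
  The coins \<open>c\<close> predict correctly all duels that are played if the tournament runs according to \<open>c\<close>.
  Unlike \<open>coins l \<sigma> beats = c\<close>, this is a condition on a fixed family of pairs of players.
\<close>

definition consistent ::
  "nat \<Rightarrow> (nat \<Rightarrow> nat) \<Rightarrow> (nat \<Rightarrow> nat \<Rightarrow> bool) \<Rightarrow> (nat \<times> nat) set \<Rightarrow> bool" where
  "consistent l \<sigma> beats c \<longleftrightarrow> (\<forall>(k, m)\<in>matches l.
     beats (\<sigma> (champ c (k - 1) (2 * m - 1))) (\<sigma> (champ c (k - 1) (2 * m))) \<longleftrightarrow> (k, m) \<in> c)"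

lemma survivor_eq_champ:
  assumes "consistent l \<sigma> beats c" "k \<le> l" "m \<in> {1..2 ^ (l - k)}"
  shows "survivor \<sigma> beats k m = \<sigma> (champ c k m)"
  using assms(2,3)
proof (induction k arbitrary: m)
  case (Suc k)
  note r = rivals_in_range[OF Suc.prems]
  show ?case
    using assms(1) r(4) Suc.IH[OF r(1,2)] Suc.IH[OF r(1,3)]
    by (auto simp: consistent_def Let_def)
qed simp

lemma survivor_eq_champ_coins:
  assumes "k \<le> l" "m \<in> {1..2 ^ (l - k)}"
  shows "survivor \<sigma> beats k m = \<sigma> (champ (coins l \<sigma> beats) k m)"
  using assms
proof (induction k arbitrary: m)
  case (Suc k)
  note r = rivals_in_range[OF Suc.prems]
  show ?case
    using r(4) Suc.IH[OF r(1,2)] Suc.IH[OF r(1,3)]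
    by (auto simp: coins_def Let_def)
qed simp

lemma coins_eq_iff_consistent:
  assumes "c \<subseteq> matches l"
  shows "coins l \<sigma> beats = c \<longleftrightarrow> consistent l \<sigma> beats c"
proof
  assume c: "coins l \<sigma> beats = c"
  show "consistent l \<sigma> beats c"
    unfolding consistent_def
  proof (intro ballI, clarify)
    fix k m assume e: "(k, m) \<in> matches l"
    then obtain k' where "k = Suc k'" "Suc k' \<le> l" "m \<in> {1..2 ^ (l - Suc k')}"
      by (elim matches_cases) auto
    then show "beats (\<sigma> (champ c (k - 1) (2 * m - 1))) (\<sigma> (champ c (k - 1) (2 * m))) \<longleftrightarrow> (k, m) \<in> c"
      using rivals_in_range[of k' l m] survivor_eq_champ_coins[of k' l _ \<sigma> beats, unfolded c] e c
      by (auto simp: coins_def)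
  qed
next
  assume con: "consistent l \<sigma> beats c"
  have "e \<in> coins l \<sigma> beats \<longleftrightarrow> e \<in> c" if e: "e \<in> matches l" for e
    using e
  proof (cases rule: matches_cases)
    case (1 k m)
    then show ?thesis
      using rivals_in_range[of k l m] survivor_eq_champ[OF con, of k] e con
      by (auto simp: coins_def consistent_def)
  qed
  moreover have "coins l \<sigma> beats \<subseteq> matches l" by (auto simp: coins_def)
  ultimately show "coins l \<sigma> beats = c" using assms by blast
qed

lemma games_won_eq_score:
  assumes "inj_on \<sigma> {1..2 ^ l}" "i \<in> {1..2 ^ l}"
  shows "real (games_won l \<sigma> beats (\<sigma> i)) = score l (coins l \<sigma> beats) i"
proof -
  have "survivor \<sigma> beats (fst e) (snd e) = \<sigma> i \<longleftrightarrow> champ (coins l \<sigma> beats) (fst e) (snd e) = i"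
    if "e \<in> matches l" for e
  proof -
    have "fst e \<le> l" "snd e \<in> {1..2 ^ (l - fst e)}" using that by (auto simp: matches_def)
    then show ?thesis
      using survivor_eq_champ_coins champ_in_range assms by (metis inj_on_contraD)
  qed
  then have "{(k, m). k \<in> {1..l} \<and> m \<in> {1..2 ^ (l - k)} \<and> survivor \<sigma> beats k m = \<sigma> i}
      = {e \<in> matches l. champ (coins l \<sigma> beats) (fst e) (snd e) = i}"
    by (force simp: matches_def)
  then show ?thesis
    unfolding games_won_def using card_champ_eq_score[OF assms(2)] by simp
qed

lemma champ_rivals:
  assumes "Suc k \<le> l" "m \<in> {1..2 ^ (l - Suc k)}"
  shows "champ c k (2 * m - 1) \<in> {1..2 ^ l}" "champ c k (2 * m) \<in> {1..2 ^ l}"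
    and "(champ c k (2 * m - 1) - 1) div 2 ^ k = 2 * m - 2"
    and "(champ c k (2 * m) - 1) div 2 ^ k = 2 * m - 1"
proof -
  note r = rivals_in_range[OF assms]
  show "champ c k (2 * m - 1) \<in> {1..2 ^ l}" "champ c k (2 * m) \<in> {1..2 ^ l}"
    by (rule champ_in_range[OF r(1,2)], rule champ_in_range[OF r(1,3)])
  have m: "m \<ge> 1" using assms(2) by simp
  then have "2 * m - 1 \<ge> 1" by simp
  from champ_block[OF this, of c k]
  show "(champ c k (2 * m - 1) - 1) div 2 ^ k = 2 * m - 2" by simp
  from m have "2 * m \<ge> 1" by simp
  from champ_block[OF this, of c k]
  show "(champ c k (2 * m) - 1) div 2 ^ k = 2 * m - 1" by simp
qed

lemma fair_duel:
  assumes "duel_outcomes M n p D" "i \<in> {1..n}" "j \<in> {1..n}" "i \<noteq> j"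
    and "p i j = 1 / 2" "p j i = 1 / 2"
  shows "measure M (D i j -` {v} \<inter> space M) = 1 / 2"
proof -
  have flip: "D j i \<omega> \<longleftrightarrow> \<not> D i j \<omega>" if "\<omega> \<in> space M" for \<omega>
    using assms(1-4) that unfolding duel_outcomes_def by blast
  have prob: "measure M {\<omega> \<in> space M. D i j \<omega>} = 1 / 2" "measure M {\<omega> \<in> space M. D j i \<omega>} = 1 / 2"
    using assms unfolding duel_outcomes_def by metis+
  have "D i j -` {v} \<inter> space M = (if v then {\<omega> \<in> space M. D i j \<omega>} else {\<omega> \<in> space M. D j i \<omega>})"
    using flip by auto
  with prob show ?thesis by simp
qed

text \<open>
  By \<open>coins_eq_iff_consistent\<close> the event that the coins equal \<open>c\<close> prescribes the outcomes of one duel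
  for each match. These duels are between distinct pairs of players, hence independent.
\<close>

lemma coins_uniform:
  assumes duel: "duel_outcomes M (2 ^ l) p D" and "l \<ge> 1"
    and fair: "\<And>i j. i \<in> {1..2 ^ l} \<Longrightarrow> j \<in> {1..2 ^ l} \<Longrightarrow> i \<noteq> j \<Longrightarrow> p i j = 1 / 2"
    and bij: "bij_betw \<sigma> {1..2 ^ l} {1..2 ^ l}"
    and c: "c \<subseteq> matches l"
  shows "{\<omega> \<in> space M. coins l \<sigma> (\<lambda>i j. D i j \<omega>) = c} \<in> sets M"
    and "measure M {\<omega> \<in> space M. coins l \<sigma> (\<lambda>i j. D i j \<omega>) = c} = 1 / 2 ^ card (matches l)"
proof -
  interpret prob_space M using duel by (simp add: duel_outcomes_def)
  let ?n = "2 ^ l :: nat" and ?I = "matches l"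
  \<comment> \<open>The positions \<open>x e\<close> and \<open>y e\<close> meet in match \<open>e\<close> under the coins \<open>c\<close>, and \<open>q e\<close> is the ordered pair
    of the players there. The outcome of the duel \<open>q e\<close> has to be \<open>v e\<close>.\<close>
  define x where "x e = champ c (fst e - 1) (2 * snd e - 1)" for e :: "nat \<times> nat"
  define y where "y e = champ c (fst e - 1) (2 * snd e)" for e :: "nat \<times> nat"
  define q where "q e = (min (\<sigma> (x e)) (\<sigma> (y e)), max (\<sigma> (x e)) (\<sigma> (y e)))" for e
  define v where "v e = ((e \<in> c) = (\<sigma> (x e) < \<sigma> (y e)))" for e
  define X where "X e = case_prod D (q e)" for e
  have inj: "inj_on \<sigma> {1..?n}" and im: "\<sigma> ` {1..?n} = {1..?n}"
    using bij by (auto simp: bij_betw_def)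
  have xy: "x e \<in> {1..?n}" "y e \<in> {1..?n}" "x e \<noteq> y e" if "e \<in> ?I" for e
    using that
  proof (atomize (full), cases rule: matches_cases)
    case (1 k m)
    then show "x e \<in> {1..?n} \<and> y e \<in> {1..?n} \<and> x e \<noteq> y e"
      using champ_rivals[OF 1(2,3), of c] by (auto simp: x_def y_def)
  qed
  have \<sigma>xy: "\<sigma> (x e) \<in> {1..?n}" "\<sigma> (y e) \<in> {1..?n}" "\<sigma> (x e) \<noteq> \<sigma> (y e)" if "e \<in> ?I" for e
    using xy[OF that] inj im by (auto simp: inj_on_eq_iff)
  have q_inj: "inj_on q ?I"
  proof (rule inj_onI)
    fix e e' assume e: "e \<in> ?I" and e': "e' \<in> ?I" and "q e = q e'"
    then have "\<sigma> ` {x e, y e} = \<sigma> ` {x e', y e'}"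
      by (auto simp: q_def min_def max_def split: if_splits)
    then have "{x e, y e} = {x e', y e'}"
      using inj xy[OF e] xy[OF e'] by (subst (asm) inj_on_image_eq_iff) auto
    then have *: "{x e - 1, y e - 1} = {x e' - 1, y e' - 1}"
      by (auto simp: doubleton_eq_iff)
    from e obtain k m where km: "e = (Suc k, m)" "Suc k \<le> l" "m \<in> {1..2 ^ (l - Suc k)}"
      by (rule matches_cases)
    from e' obtain k' m' where km': "e' = (Suc k', m')" "Suc k' \<le> l" "m' \<in> {1..2 ^ (l - Suc k')}"
      by (rule matches_cases)
    have "k = k' \<and> m = m'"
      by (rule meeting_determines_match[OF _ _ *])
        (use km km' champ_rivals[OF km(2,3), of c] champ_rivals[OF km'(2,3), of c]
          in \<open>auto simp: x_def y_def\<close>)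
    with km km' show "e = e'" by simp
  qed
  have q_range: "q e \<in> {(i, j). 1 \<le> i \<and> i < j \<and> j \<le> ?n}" if "e \<in> ?I" for e
    using \<sigma>xy[OF that] by (cases "\<sigma> (x e) < \<sigma> (y e)") (auto simp: q_def)
  then have q_sub: "q ` ?I \<subseteq> {(i, j). 1 \<le> i \<and> i < j \<and> j \<le> ?n}"
    by (rule image_subsetI)
  have indep: "indep_vars (\<lambda>_. count_space UNIV) (case_prod D) (q ` ?I)"
    by (rule indep_vars_subset[OF _ q_sub]) (use duel in \<open>simp only: duel_outcomes_def\<close>)
  have D_flip: "D j i \<omega> \<longleftrightarrow> \<not> D i j \<omega>"
    if "i \<in> {1..?n}" "j \<in> {1..?n}" "i \<noteq> j" "\<omega> \<in> space M" for i j \<omega>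
    using duel that unfolding duel_outcomes_def by blast
  have X_iff: "X e \<omega> = v e \<longleftrightarrow> (D (\<sigma> (x e)) (\<sigma> (y e)) \<omega> \<longleftrightarrow> e \<in> c)"
    if "e \<in> ?I" "\<omega> \<in> space M" for e \<omega>
    using \<sigma>xy[OF that(1)] D_flip[OF \<sigma>xy[OF that(1)] that(2)]
    by (cases "\<sigma> (x e) < \<sigma> (y e)") (auto simp: X_def v_def q_def)
  have "(l, 1) \<in> ?I"
    using \<open>l \<ge> 1\<close> by (simp add: matches_def)
  then have ne: "?I \<noteq> {}" by blast
  have event: "{\<omega> \<in> space M. coins l \<sigma> (\<lambda>i j. D i j \<omega>) = c}
      = (\<Inter>e\<in>?I. X e -` {v e} \<inter> space M)"
  proof (intro set_eqI)
    fix \<omega>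
    have "coins l \<sigma> (\<lambda>i j. D i j \<omega>) = c \<longleftrightarrow> (\<forall>e\<in>?I. X e \<omega> = v e)" if "\<omega> \<in> space M"
      using that X_iff
      by (auto simp: coins_eq_iff_consistent[OF c] consistent_def x_def y_def)
    with ne show "\<omega> \<in> {\<omega> \<in> space M. coins l \<sigma> (\<lambda>i j. D i j \<omega>) = c}
        \<longleftrightarrow> \<omega> \<in> (\<Inter>e\<in>?I. X e -` {v e} \<inter> space M)" by auto
  qed
  have meas: "X e \<in> measurable M (count_space UNIV)" if "e \<in> ?I" for e
    using indep that by (simp add: indep_vars_def X_def)
  show "{\<omega> \<in> space M. coins l \<sigma> (\<lambda>i j. D i j \<omega>) = c} \<in> sets M"
    unfolding event using finite_matches[of l] ne meas
    by (intro sets.finite_INT) (auto intro: measurable_sets)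
  have half: "prob (X e -` {v e} \<inter> space M) = 1 / 2" if "e \<in> ?I" for e
  proof -
    obtain i j where ij: "q e = (i, j)" by fastforce
    with q_range[OF that] have "i \<in> {1..?n}" "j \<in> {1..?n}" "i \<noteq> j"
      by auto
    from fair_duel[OF duel this] fair this ij show ?thesis
      by (simp add: X_def)
  qed
  define w where "w = v \<circ> the_inv_into ?I q"
  have w: "w (q e) = v e" if "e \<in> ?I" for e
    using that q_inj by (simp add: w_def the_inv_into_f_f)
  have "prob (\<Inter>e\<in>?I. X e -` {v e} \<inter> space M)
      = prob (\<Inter>d\<in>q ` ?I. case_prod D d -` {w d} \<inter> space M)"
    by (simp add: X_def w)
  also have "\<dots> = (\<Prod>d\<in>q ` ?I. prob (case_prod D d -` {w d} \<inter> space M))"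
    by (rule indep_varsD[OF indep]) (use ne finite_matches in auto)
  also have "\<dots> = (\<Prod>e\<in>?I. prob (X e -` {v e} \<inter> space M))"
    by (simp add: prod.reindex[OF q_inj] X_def w)
  also have "\<dots> = 1 / 2 ^ card ?I"
    by (simp add: half power_one_over)
  finally show "prob {\<omega> \<in> space M. coins l \<sigma> (\<lambda>i j. D i j \<omega>) = c} = 1 / 2 ^ card ?I"
    unfolding event .
qed

section \<open>Random elements with finitely many values\<close>

lemma integrable_finite_range:
  fixes f :: "'b \<Rightarrow> real"
  assumes "finite_measure M" "finite V"
    and "\<And>v. v \<in> V \<Longrightarrow> {\<omega> \<in> space M. Z \<omega> = v} \<in> sets M"
    and "\<And>\<omega>. \<omega> \<in> space M \<Longrightarrow> Z \<omega> \<in> V"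
  shows "integrable M (\<lambda>\<omega>. f (Z \<omega>))"
proof -
  interpret finite_measure M by fact
  have eq: "f (Z \<omega>) = (\<Sum>v\<in>V. f v * indicator {\<omega> \<in> space M. Z \<omega> = v} \<omega>)" if "\<omega> \<in> space M" for \<omega>
  proof -
    have "(\<Sum>v\<in>V. f v * indicator {\<omega> \<in> space M. Z \<omega> = v} \<omega>) = (\<Sum>v\<in>V. if v = Z \<omega> then f v else 0)"
      using that by (intro sum.cong) (auto simp: indicator_def)
    with assms that show ?thesis by simp
  qed
  have "integrable M (\<lambda>\<omega>. \<Sum>v\<in>V. f v * indicator {\<omega> \<in> space M. Z \<omega> = v} \<omega>)"
    using assms(3) by (intro Bochner_Integration.integrable_sum integrable_mult_right
      integrable_real_indicator) (auto simp: less_top[symmetric])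
  then show ?thesis using eq by (simp cong: Bochner_Integration.integrable_cong)
qed

text \<open>
  The values need to lie in \<open>V\<close> only almost surely, as holds for an independent version.
\<close>

lemma integral_finite_range:
  fixes f :: "'b \<Rightarrow> real"
  assumes "finite_measure M" "finite V"
    and "\<And>v. v \<in> V \<Longrightarrow> {\<omega> \<in> space M. Z \<omega> = v} \<in> sets M"
    and "AE \<omega> in M. Z \<omega> \<in> V" "(\<lambda>\<omega>. f (Z \<omega>)) \<in> borel_measurable M"
  shows "(\<integral>\<omega>. f (Z \<omega>) \<partial>M) = (\<Sum>v\<in>V. f v * measure M {\<omega> \<in> space M. Z \<omega> = v})"
proof -
  interpret finite_measure M by fact
  have eq: "f (Z \<omega>) = (\<Sum>v\<in>V. f v * indicator {\<omega> \<in> space M. Z \<omega> = v} \<omega>)"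
    if "\<omega> \<in> space M" "Z \<omega> \<in> V" for \<omega>
  proof -
    have "(\<Sum>v\<in>V. f v * indicator {\<omega> \<in> space M. Z \<omega> = v} \<omega>) = (\<Sum>v\<in>V. if v = Z \<omega> then f v else 0)"
      using that by (intro sum.cong) (auto simp: indicator_def)
    with assms that show ?thesis by simp
  qed
  have int: "integrable M (\<lambda>\<omega>. f v * indicator {\<omega> \<in> space M. Z \<omega> = v} \<omega>)" if "v \<in> V" for v
    using assms(3)[OF that] by (intro integrable_mult_right integrable_real_indicator)
      (auto simp: less_top[symmetric])
  have "(\<integral>\<omega>. f (Z \<omega>) \<partial>M) = (\<integral>\<omega>. (\<Sum>v\<in>V. f v * indicator {\<omega> \<in> space M. Z \<omega> = v} \<omega>) \<partial>M)"
  proof (rule integral_cong_AE)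
    show "AE \<omega> in M. f (Z \<omega>) = (\<Sum>v\<in>V. f v * indicator {\<omega> \<in> space M. Z \<omega> = v} \<omega>)"
      using assms(4) AE_space by eventually_elim (rule eq)
    show "(\<lambda>\<omega>. \<Sum>v\<in>V. f v * indicator {\<omega> \<in> space M. Z \<omega> = v} \<omega>) \<in> borel_measurable M"
      using int by (intro borel_measurable_integrable Bochner_Integration.integrable_sum)
  qed fact
  also have "\<dots> = (\<Sum>v\<in>V. f v * measure M {\<omega> \<in> space M. Z \<omega> = v})"
    using int assms(3) by (simp add: Bochner_Integration.integral_sum Int_absorb1 sets.sets_into_space)
  finally show ?thesis .
qed

lemma covariance_eq:
  assumes "prob_space M" "covariance_exists M f g"
  shows "covariance M f g = (\<integral>\<omega>. f \<omega> * g \<omega> \<partial>M) - (\<integral>\<omega>. f \<omega> \<partial>M) * (\<integral>\<omega>. g \<omega> \<partial>M)"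
proof -
  interpret prob_space M by fact
  have [simp]: "integrable M f" "integrable M g" "integrable M (\<lambda>\<omega>. f \<omega> * g \<omega>)"
    using assms(2) by (auto simp: covariance_exists_def)
  define a b where "a = expectation f" and "b = expectation g"
  have "covariance M f g = expectation (\<lambda>\<omega>. f \<omega> * g \<omega> - b * f \<omega> - a * g \<omega> + a * b)"
    by (simp add: covariance_def a_def b_def algebra_simps)
  also have "\<dots> = expectation (\<lambda>\<omega>. f \<omega> * g \<omega>) - b * a - a * b + a * b"
    by (simp add: prob_space flip: a_def b_def)
  finally show ?thesis by (simp add: a_def b_def)
qed

section \<open>Negative association implies negative supermodular dependence\<close>

lemma restrict_eq_sets:
  assumes "finite I" "\<And>j. j \<in> I \<Longrightarrow> X j \<in> borel_measurable M" "v \<in> extensional I"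
  shows "{\<omega> \<in> space M. (\<lambda>j\<in>I. X j \<omega> :: real) = v} \<in> sets M"
proof -
  have "{\<omega> \<in> space M. (\<lambda>j\<in>I. X j \<omega>) = v} = {\<omega> \<in> space M. \<forall>j\<in>I. X j \<omega> = v j}"
    using assms(3) by (auto simp: fun_eq_iff extensional_def)
  also have "\<dots> \<in> sets M"
  proof (rule sets.sets_Collect_finite_All[OF _ assms(1)])
    fix j assume "j \<in> I"
    have "{\<omega> \<in> space M. X j \<omega> = v j} = X j -` {v j} \<inter> space M" by auto
    also have "\<dots> \<in> sets M"
      using assms(2)[OF \<open>j \<in> I\<close>] by (rule measurable_sets) simp
    finally show "{\<omega> \<in> space M. X j \<omega> = v j} \<in> sets M" .
  qed
  finally show ?thesis .
qed

lemma integrable_random_vector: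
  assumes "random_vector M I X" "finite V" "\<And>j \<omega>. j \<in> I \<Longrightarrow> \<omega> \<in> space M \<Longrightarrow> X j \<omega> \<in> V"
  shows "integrable M (\<lambda>\<omega>. h (\<lambda>j\<in>I. X j \<omega>) :: real)"
proof (rule integrable_finite_range[where f = h and Z = "\<lambda>\<omega>. \<lambda>j\<in>I. X j \<omega>" and V = "PiE I (\<lambda>_. V)"])
  show "finite_measure M"
    using assms(1) by (simp add: random_vector_def prob_space_def)
  show "finite (PiE I (\<lambda>_. V))"
    using assms by (intro finite_PiE) (auto simp: random_vector_def)
  show "{\<omega> \<in> space M. (\<lambda>j\<in>I. X j \<omega>) = v} \<in> sets M" if "v \<in> PiE I (\<lambda>_. V)" for v
    using that assms(1) by (intro restrict_eq_sets) (auto simp: random_vector_def PiE_def)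
  show "(\<lambda>j\<in>I. X j \<omega>) \<in> PiE I (\<lambda>_. V)" if "\<omega> \<in> space M" for \<omega>
    using that assms(3) by auto
qed

lemma telescope:
  fixes h :: "nat \<Rightarrow> real"
  assumes "n \<le> l"
  shows "h n = h 0 + (\<Sum>t<l. (if Suc t \<le> n then 1 else 0) * (h (Suc t) - h t))"
proof -
  have "(\<Sum>t<l. (if Suc t \<le> n then 1 else 0) * (h (Suc t) - h t)) = (\<Sum>t<n. h (Suc t) - h t)"
    using assms by (intro sum.mono_neutral_cong_right) auto
  then show ?thesis by (simp add: sum_lessThan_telescope)
qed

lemma upd_in_PiE_UNIV: "r \<in> I \<rightarrow>\<^sub>E UNIV \<Longrightarrow> r(i := a) \<in> insert i I \<rightarrow>\<^sub>E UNIV"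
  by (auto simp: PiE_def extensional_def)

lemma supermodular_section:
  assumes "supermodular (insert i I) \<psi>"
  shows "supermodular I (\<lambda>r. \<psi> (r(i := a)))"
proof -
  have "(sup x y)(i := a) = sup (x(i := a)) (y(i := a))"
    "(inf x y)(i := a) = inf (x(i := a)) (y(i := a))" for x y :: "'a \<Rightarrow> real"
    by (auto simp: fun_eq_iff)
  with assms show ?thesis
    by (simp add: supermodular_def upd_in_PiE_UNIV)
qed

lemma supermodular_increments_mono:
  fixes a b :: real
  assumes "supermodular (insert i I) \<psi>" "a \<le> b"
  shows "mono_on (I \<rightarrow>\<^sub>E UNIV) (\<lambda>r. \<psi> (r(i := b)) - \<psi> (r(i := a)))"
proof (rule mono_onI)
  fix r r' :: "'a \<Rightarrow> real"
  assume r: "r \<in> I \<rightarrow>\<^sub>E UNIV" "r' \<in> I \<rightarrow>\<^sub>E UNIV" "r \<le> r'"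
  have "sup (r(i := b)) (r'(i := a)) = r'(i := b)" "inf (r(i := b)) (r'(i := a)) = r(i := a)"
    using r(3) assms(2) by (auto simp: fun_eq_iff le_fun_def sup_absorb1 sup_absorb2 inf_absorb1 inf_absorb2)
  then show "\<psi> (r(i := b)) - \<psi> (r(i := a)) \<le> \<psi> (r'(i := b)) - \<psi> (r'(i := a))"
    using assms(1) upd_in_PiE_UNIV[OF r(1), of i b] upd_in_PiE_UNIV[OF r(2), of i a]
    unfolding supermodular_def by force
qed

lemma negatively_associated_subset:
  assumes "negatively_associated M I X" "J \<subseteq> I"
  shows "negatively_associated M J X"
proof -
  have "random_vector M J X"
    using assms finite_subset by (auto simp: negatively_associated_def random_vector_def)
  then show ?thesis
    using assms unfolding negatively_associated_def by (meson order_trans)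
qed

lemma negatively_associated_integral_le:
  assumes "negatively_associated M I X" "A \<subseteq> I" "B \<subseteq> I" "A \<inter> B = {}"
    and "mono_on (A \<rightarrow>\<^sub>E UNIV) \<phi>" "mono_on (B \<rightarrow>\<^sub>E UNIV) \<psi>"
    and "covariance_exists M (\<lambda>\<omega>. \<phi> (\<lambda>i\<in>A. X i \<omega>)) (\<lambda>\<omega>. \<psi> (\<lambda>i\<in>B. X i \<omega>))"
  shows "(\<integral>\<omega>. \<phi> (\<lambda>i\<in>A. X i \<omega>) * \<psi> (\<lambda>i\<in>B. X i \<omega>) \<partial>M)
    \<le> (\<integral>\<omega>. \<phi> (\<lambda>i\<in>A. X i \<omega>) \<partial>M) * (\<integral>\<omega>. \<psi> (\<lambda>i\<in>B. X i \<omega>) \<partial>M)"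
proof -
  have "prob_space M" using assms(1) by (simp add: negatively_associated_def random_vector_def)
  moreover have "covariance M (\<lambda>\<omega>. \<phi> (\<lambda>i\<in>A. X i \<omega>)) (\<lambda>\<omega>. \<psi> (\<lambda>i\<in>B. X i \<omega>)) \<le> 0"
    using assms unfolding negatively_associated_def by blast
  ultimately show ?thesis using covariance_eq assms(7) by fastforce
qed

text \<open>
  Replacing the component \<open>X i\<close> by an independent copy does not decrease the expectation of a
  supermodular function.
\<close>

lemma supermodular_decouple_one:
  fixes X :: "'i \<Rightarrow> 'a \<Rightarrow> real"
  assumes NA: "negatively_associated M (insert i I) X" and "i \<notin> I"
    and range: "\<And>j \<omega>. j \<in> insert i I \<Longrightarrow> \<omega> \<in> space M \<Longrightarrow> X j \<omega> \<in> real ` {..l}"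
    and sm: "supermodular (insert i I) \<psi>"
  shows "(\<integral>\<omega>. \<psi> (\<lambda>j\<in>insert i I. X j \<omega>) \<partial>M)
    \<le> (\<Sum>a\<in>real ` {..l}. (\<integral>\<omega>. \<psi> ((\<lambda>j\<in>I. X j \<omega>)(i := a)) \<partial>M) * measure M {\<omega> \<in> space M. X i \<omega> = a})"
proof -
  have rv: "random_vector M (insert i I) X"
    using NA by (simp add: negatively_associated_def)
  then interpret prob_space M by (simp add: random_vector_def)
  define R where "R \<omega> = (\<lambda>j\<in>I. X j \<omega>)" for \<omega>
  define N where "N \<omega> = nat \<lfloor>X i \<omega>\<rfloor>" for \<omega>
  have N: "X i \<omega> = real (N \<omega>)" "N \<omega> \<le> l" if "\<omega> \<in> space M" for \<omega>
    using range[of i \<omega>] that by (auto simp: N_def)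
  define T :: "nat \<Rightarrow> 'a \<Rightarrow> real" where "T t \<omega> = (if real (Suc t) \<le> X i \<omega> then 1 else 0)" for t \<omega>
  define g where "g a r = \<psi> (r(i := real a))" for a r
  define G where "G a = expectation (\<lambda>\<omega>. g a (R \<omega>))" for a
  have full: "(\<lambda>j\<in>insert i I. X j \<omega>) = (R \<omega>)(i := X i \<omega>)" for \<omega>
    by (auto simp: R_def fun_eq_iff)
  have int: "integrable M (\<lambda>\<omega>. h (X i \<omega>) (R \<omega>))" for h :: "real \<Rightarrow> ('i \<Rightarrow> real) \<Rightarrow> real"
  proof -
    have "integrable M (\<lambda>\<omega>. (\<lambda>v. h (v i) (restrict v I)) (\<lambda>j\<in>insert i I. X j \<omega>))"
      by (rule integrable_random_vector[OF rv _ range]) auto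
    moreover have "restrict (\<lambda>j\<in>insert i I. X j \<omega>) I = R \<omega>" for \<omega>
      by (auto simp: R_def fun_eq_iff)
    ultimately show ?thesis by simp
  qed
  have int_g: "integrable M (\<lambda>\<omega>. g a (R \<omega>))" for a
    using int[of "\<lambda>_. g a"] .
  have int_T: "integrable M (T t)" for t
    using int[of "\<lambda>x _. if real (Suc t) \<le> x then 1 else 0"] by (simp add: T_def[abs_def])
  have int_Tg: "integrable M (\<lambda>\<omega>. T t \<omega> * (g (Suc t) (R \<omega>) - g t (R \<omega>)))" for t
    using int[of "\<lambda>x r. (if real (Suc t) \<le> x then 1 else 0) * (g (Suc t) r - g t r)"]
    by (simp only: T_def)
  have step: "expectation (\<lambda>\<omega>. T t \<omega> * (g (Suc t) (R \<omega>) - g t (R \<omega>)))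
      \<le> expectation (T t) * (G (Suc t) - G t)" for t
  proof -
    let ?\<phi> = "\<lambda>x :: 'i \<Rightarrow> real. if real (Suc t) \<le> x i then 1 else 0 :: real"
    have T: "?\<phi> (\<lambda>j\<in>{i}. X j \<omega>) = T t \<omega>" for \<omega> by (simp add: T_def)
    have "mono_on ({i} \<rightarrow>\<^sub>E UNIV) ?\<phi>"
      by (rule mono_onI) (auto simp: le_fun_def dest: order_trans)
    moreover have "mono_on (I \<rightarrow>\<^sub>E UNIV) (\<lambda>r. g (Suc t) r - g t r)"
      unfolding g_def by (intro supermodular_increments_mono[OF sm]) simp
    moreover have "covariance_exists M (\<lambda>\<omega>. ?\<phi> (\<lambda>j\<in>{i}. X j \<omega>))
        (\<lambda>\<omega>. (\<lambda>r. g (Suc t) r - g t r) (\<lambda>j\<in>I. X j \<omega>))"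
      unfolding covariance_exists_def T R_def[symmetric]
      using int_T int_g int_Tg by simp
    ultimately have "expectation (\<lambda>\<omega>. ?\<phi> (\<lambda>j\<in>{i}. X j \<omega>) * (g (Suc t) (R \<omega>) - g t (R \<omega>)))
        \<le> expectation (\<lambda>\<omega>. ?\<phi> (\<lambda>j\<in>{i}. X j \<omega>)) * expectation (\<lambda>\<omega>. g (Suc t) (R \<omega>) - g t (R \<omega>))"
      unfolding R_def using \<open>i \<notin> I\<close>
      by (intro negatively_associated_integral_le[OF NA, of "{i}" I ?\<phi> "\<lambda>r. g (Suc t) r - g t r"])
        (blast | assumption)+
    then show ?thesis
      unfolding T by (simp add: G_def int_g)
  qed
  \<comment> \<open>This decomposition is applied twice: with \<open>h a = g a (R \<omega>)\<close>, and in the reverse direction with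
    \<open>h = G\<close>.\<close>
  have tele: "h (N \<omega>) = h 0 + (\<Sum>t<l. T t \<omega> * (h (Suc t) - h t))"
    if "\<omega> \<in> space M" for \<omega> and h :: "nat \<Rightarrow> real"
    using telescope[OF N(2)[OF that], of h] by (simp only: T_def N(1)[OF that] of_nat_le_iff)
  have "expectation (\<lambda>\<omega>. \<psi> (\<lambda>j\<in>insert i I. X j \<omega>))
      = expectation (\<lambda>\<omega>. g 0 (R \<omega>) + (\<Sum>t<l. T t \<omega> * (g (Suc t) (R \<omega>) - g t (R \<omega>))))"
  proof (rule Bochner_Integration.integral_cong[OF refl])
    fix \<omega> assume \<omega>: "\<omega> \<in> space M"
    have "\<psi> (\<lambda>j\<in>insert i I. X j \<omega>) = g (N \<omega>) (R \<omega>)"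
      unfolding full g_def N(1)[OF \<omega>] ..
    with tele[OF \<omega>, of "\<lambda>a. g a (R \<omega>)"]
    show "\<psi> (\<lambda>j\<in>insert i I. X j \<omega>) = g 0 (R \<omega>) + (\<Sum>t<l. T t \<omega> * (g (Suc t) (R \<omega>) - g t (R \<omega>)))"
      by simp
  qed
  also have "\<dots> = G 0 + (\<Sum>t<l. expectation (\<lambda>\<omega>. T t \<omega> * (g (Suc t) (R \<omega>) - g t (R \<omega>))))"
    using int_g int_Tg by (simp add: G_def Bochner_Integration.integral_add Bochner_Integration.integral_sum)
  also have "\<dots> \<le> G 0 + (\<Sum>t<l. expectation (T t) * (G (Suc t) - G t))"
    by (intro add_left_mono sum_mono step)
  also have "\<dots> = expectation (\<lambda>\<omega>. G 0 + (\<Sum>t<l. T t \<omega> * (G (Suc t) - G t)))"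
    using int_T by (simp add: Bochner_Integration.integral_add Bochner_Integration.integral_sum prob_space)
  also have "\<dots> = expectation (\<lambda>\<omega>. G (nat \<lfloor>X i \<omega>\<rfloor>))"
    by (rule Bochner_Integration.integral_cong[OF refl]) (simp only: tele[symmetric] N_def)
  also have "\<dots> = (\<Sum>a\<in>real ` {..l}. G (nat \<lfloor>a\<rfloor>) * prob {\<omega> \<in> space M. X i \<omega> = a})"
  proof (rule integral_finite_range)
    have Xi: "X i \<in> borel_measurable M" using rv by (simp add: random_vector_def)
    then show "{\<omega> \<in> space M. X i \<omega> = a} \<in> sets M" for a by simp
    show "AE \<omega> in M. X i \<omega> \<in> real ` {..l}" using range by (intro AE_I2) simp
    show "(\<lambda>\<omega>. G (nat \<lfloor>X i \<omega>\<rfloor>)) \<in> borel_measurable M"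
      using int[of "\<lambda>x _. G (nat \<lfloor>x\<rfloor>)"] by simp
  qed (auto simp: finite_measure_axioms)
  also have "\<dots> = (\<Sum>a\<in>real ` {..l}. expectation (\<lambda>\<omega>. \<psi> ((R \<omega>)(i := a))) * prob {\<omega> \<in> space M. X i \<omega> = a})"
    by (intro sum.cong) (auto simp: G_def g_def)
  finally show ?thesis by (simp only: R_def)
qed

text \<open>
  The right-hand side is the expectation of \<open>\<psi>\<close> under the product of the marginal distributions.
\<close>

lemma supermodular_le_independent:
  fixes X :: "'i \<Rightarrow> 'a \<Rightarrow> real"
  assumes "finite I" "negatively_associated M I X"
    and "\<And>j \<omega>. j \<in> I \<Longrightarrow> \<omega> \<in> space M \<Longrightarrow> X j \<omega> \<in> real ` {..l}"
    and "supermodular I \<psi>"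
  shows "(\<integral>\<omega>. \<psi> (\<lambda>j\<in>I. X j \<omega>) \<partial>M)
    \<le> (\<Sum>v\<in>PiE I (\<lambda>_. real ` {..l}). \<psi> v * (\<Prod>j\<in>I. measure M {\<omega> \<in> space M. X j \<omega> = v j}))"
  using assms
proof (induction I arbitrary: \<psi> rule: finite_induct)
  case empty
  then interpret prob_space M by (simp add: negatively_associated_def random_vector_def)
  show ?case by (simp add: prob_space restrict_def)
next
  case (insert i I)
  let ?V = "real ` {..l}" and ?P = "\<lambda>j a. measure M {\<omega> \<in> space M. X j \<omega> = a}"
  have NA: "negatively_associated M I X"
    using insert.prems(1) by (rule negatively_associated_subset) auto
  have "(\<integral>\<omega>. \<psi> (\<lambda>j\<in>insert i I. X j \<omega>) \<partial>M)
      \<le> (\<Sum>a\<in>?V. (\<integral>\<omega>. \<psi> ((\<lambda>j\<in>I. X j \<omega>)(i := a)) \<partial>M) * ?P i a)"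
    by (rule supermodular_decouple_one[OF insert.prems(1) insert.hyps(2) insert.prems(2,3)])
  also have "\<dots> \<le> (\<Sum>a\<in>?V. (\<Sum>v\<in>PiE I (\<lambda>_. ?V). \<psi> (v(i := a)) * (\<Prod>j\<in>I. ?P j (v j))) * ?P i a)"
    using insert.prems(2)
    by (intro sum_mono mult_right_mono insert.IH NA supermodular_section insert.prems(3)) auto
  also have "\<dots> = (\<Sum>(a, v)\<in>?V \<times> PiE I (\<lambda>_. ?V). \<psi> (v(i := a)) * (\<Prod>j\<in>I. ?P j (v j)) * ?P i a)"
    by (simp add: sum_distrib_right sum.cartesian_product)
  also have "\<dots> = (\<Sum>(a, v)\<in>?V \<times> PiE I (\<lambda>_. ?V).
      \<psi> (v(i := a)) * (\<Prod>j\<in>insert i I. ?P j ((v(i := a)) j)))"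
  proof (intro sum.cong refl, clarify)
    fix a v
    have "(\<Prod>j\<in>I. ?P j ((v(i := a)) j)) = (\<Prod>j\<in>I. ?P j (v j))"
      using insert.hyps(2) by (intro prod.cong) auto
    then show "\<psi> (v(i := a)) * (\<Prod>j\<in>I. ?P j (v j)) * ?P i a
        = \<psi> (v(i := a)) * (\<Prod>j\<in>insert i I. ?P j ((v(i := a)) j))"
      using insert.hyps by (simp add: mult_ac)
  qed
  also have "\<dots> = (\<Sum>v\<in>PiE (insert i I) (\<lambda>_. ?V). \<psi> v * (\<Prod>j\<in>insert i I. ?P j (v j)))"
    unfolding PiE_insert_eq
    by (subst sum.reindex[OF inj_combinator[OF insert.hyps(2)]]) (simp add: case_prod_unfold)
  finally show ?case .
qed

lemma negatively_associated_imp_NSMD: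
  fixes X :: "'i \<Rightarrow> 'a \<Rightarrow> real"
  assumes NA: "negatively_associated M I X"
    and range: "\<And>j \<omega>. j \<in> I \<Longrightarrow> \<omega> \<in> space M \<Longrightarrow> X j \<omega> \<in> real ` {..l}"
  shows "NSMD M I X"
  unfolding NSMD_def
proof (intro conjI allI impI)
  show rv: "random_vector M I X"
    using NA by (simp add: negatively_associated_def)
  then interpret M: prob_space M by (simp add: random_vector_def)
  have fin: "finite I" using rv by (simp add: random_vector_def)
  fix N :: "('i \<Rightarrow> real) measure" and Y \<psi>
  assume ind: "independent_version M N I X Y" and sm: "supermodular I \<psi>"
    and int: "integrable N (\<lambda>\<omega>. \<psi> (\<lambda>i\<in>I. Y i \<omega>))"
  then have rvY: "random_vector N I Y" by (simp add: independent_version_def)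
  then interpret N: prob_space N by (simp add: random_vector_def)
  let ?V = "real ` {..l}"
  have X: "X j \<in> borel_measurable M" and Y: "Y j \<in> borel_measurable N" if "j \<in> I" for j
    using rv rvY that by (auto simp: random_vector_def)
  have law: "measure N (Y j -` A \<inter> space N) = measure M (X j -` A \<inter> space M)"
    if "j \<in> I" "A \<in> sets borel" for j A
    using ind that measure_distr[OF X[OF that(1)], of A] measure_distr[OF Y[OF that(1)], of A]
    by (simp add: independent_version_def)
  have V: "?V \<in> sets borel" by (intro borel_closed finite_imp_closed) simp
  have "AE \<omega> in N. Y j \<omega> \<in> ?V" if "j \<in> I" for j
  proof -
    have "X j -` ?V \<inter> space M = space M" using range that by auto
    then have "measure N (Y j -` ?V \<inter> space N) = 1"
      using law[OF that V] by (simp add: M.prob_space)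
    moreover have "Y j -` ?V \<inter> space N \<in> sets N"
      using Y[OF that] V by (rule measurable_sets)
    ultimately have "AE \<omega> in N. \<omega> \<in> Y j -` ?V \<inter> space N"
      using N.AE_in_set_eq_1 by blast
    then show ?thesis by eventually_elim auto
  qed
  then have AE: "AE \<omega> in N. \<forall>j\<in>I. Y j \<omega> \<in> ?V"
    using fin by (rule AE_finite_allI[rotated])
  have prob: "measure N {\<omega> \<in> space N. (\<lambda>j\<in>I. Y j \<omega>) = v}
      = (\<Prod>j\<in>I. measure M {\<omega> \<in> space M. X j \<omega> = v j})" if v: "v \<in> PiE I (\<lambda>_. ?V)" for v
  proof (cases "I = {}")
    case True
    with v show ?thesis by (simp add: N.prob_space restrict_def)
  next
    case False
    have "N.indep_vars (\<lambda>_. borel) Y I"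
      using ind by (simp add: independent_version_def)
    then have "measure N (\<Inter>j\<in>I. Y j -` {v j} \<inter> space N) = (\<Prod>j\<in>I. measure N (Y j -` {v j} \<inter> space N))"
      using False fin by (intro N.indep_varsD) auto
    also have "(\<Inter>j\<in>I. Y j -` {v j} \<inter> space N) = {\<omega> \<in> space N. (\<lambda>j\<in>I. Y j \<omega>) = v}"
      using False v by (auto simp: fun_eq_iff PiE_def extensional_def)
    also have "(\<Prod>j\<in>I. measure N (Y j -` {v j} \<inter> space N))
        = (\<Prod>j\<in>I. measure M {\<omega> \<in> space M. X j \<omega> = v j})"
    proof (rule prod.cong[OF refl])
      fix j assume "j \<in> I"
      moreover have "X j -` {v j} \<inter> space M = {\<omega> \<in> space M. X j \<omega> = v j}" by auto
      ultimately show "measure N (Y j -` {v j} \<inter> space N) = measure M {\<omega> \<in> space M. X j \<omega> = v j}"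
        using law[of j "{v j}"] by simp
    qed
    finally show ?thesis .
  qed
  have "(\<integral>\<omega>. \<psi> (\<lambda>i\<in>I. X i \<omega>) \<partial>M)
      \<le> (\<Sum>v\<in>PiE I (\<lambda>_. ?V). \<psi> v * (\<Prod>j\<in>I. measure M {\<omega> \<in> space M. X j \<omega> = v j}))"
    by (rule supermodular_le_independent[OF fin NA range sm])
  also have "\<dots> = (\<Sum>v\<in>PiE I (\<lambda>_. ?V). \<psi> v * measure N {\<omega> \<in> space N. (\<lambda>j\<in>I. Y j \<omega>) = v})"
    by (intro sum.cong) (simp_all add: prob)
  also have "\<dots> = (\<integral>\<omega>. \<psi> (\<lambda>i\<in>I. Y i \<omega>) \<partial>N)"
  proof (rule integral_finite_range[symmetric])
    show "finite (PiE I (\<lambda>_. ?V))" using fin by (intro finite_PiE) auto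
    show "{\<omega> \<in> space N. (\<lambda>j\<in>I. Y j \<omega>) = v} \<in> sets N" if "v \<in> PiE I (\<lambda>_. ?V)" for v
      using fin Y that by (intro restrict_eq_sets) (auto simp: PiE_def)
    show "AE \<omega> in N. (\<lambda>j\<in>I. Y j \<omega>) \<in> PiE I (\<lambda>_. ?V)"
      using AE by eventually_elim auto
    show "(\<lambda>\<omega>. \<psi> (\<lambda>i\<in>I. Y i \<omega>)) \<in> borel_measurable N" using int by simp
  qed (rule N.finite_measure_axioms)
  finally show "(\<integral>\<omega>. \<psi> (\<lambda>i\<in>I. X i \<omega>) \<partial>M) \<le> (\<integral>\<omega>. \<psi> (\<lambda>i\<in>I. Y i \<omega>) \<partial>N)" .
qed

section \<open>Negative dependence in the tournament\<close>

lemma coins_subset: "coins l \<sigma> beats \<in> Pow (matches l)"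
  by (auto simp: coins_def)

lemma mono_in_reindexed_restrict:
  assumes "mono_on (A \<rightarrow>\<^sub>E UNIV) \<phi>"
  shows "mono_in (h ` A) (\<lambda>x. \<phi> (\<lambda>i\<in>A. x (h i)))"
  unfolding mono_in_def
proof (intro allI impI)
  fix x y :: "'b \<Rightarrow> real" assume "\<forall>j\<in>h ` A. x j \<le> y j"
  then show "\<phi> (\<lambda>i\<in>A. x (h i)) \<le> \<phi> (\<lambda>i\<in>A. y (h i))"
    by (intro mono_onD[OF assms]) (auto simp: le_fun_def)
qed

theorem theorem3p9:
  fixes M :: "'a measure" and l n :: nat
    and p :: "nat \<Rightarrow> nat \<Rightarrow> real" and D :: "nat \<Rightarrow> nat \<Rightarrow> 'a \<Rightarrow> bool"
    and \<sigma> :: "nat \<Rightarrow> nat" and S :: "nat \<Rightarrow> 'a \<Rightarrow> real"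
  assumes "l \<ge> 2" and "n = 2 ^ l"
    and "duel_outcomes M n p D"
    and "\<And>i j. i \<in> {1..n} \<Longrightarrow> j \<in> {1..n} \<Longrightarrow> i \<noteq> j \<Longrightarrow> p i j = 1 / 2"
    and "bij_betw \<sigma> {1..n} {1..n}"
    and "\<And>i \<omega>. S i \<omega> = real (games_won l \<sigma> (\<lambda>i j. D i j \<omega>) i)"
  shows "negatively_associated M {1..n} S \<and> NSMD M {1..n} S"
proof -
  interpret prob_space M using assms(3) by (simp add: duel_outcomes_def)
  define C where "C \<omega> = coins l \<sigma> (\<lambda>i j. D i j \<omega>)" for \<omega>
  define pos where "pos = the_inv_into {1..n} \<sigma>"
  have inj: "inj_on \<sigma> {1..n}" and im: "\<sigma> ` {1..n} = {1..n}"
    using assms(5) by (auto simp: bij_betw_def)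
  have pos: "pos i \<in> {1..n}" "\<sigma> (pos i) = i" if "i \<in> {1..n}" for i
    using the_inv_into_into[OF inj _ order_refl, of i] f_the_inv_into_f[OF inj, of i] that
    unfolding im pos_def by blast+
  have S: "S i \<omega> = score l (C \<omega>) (pos i)" if "i \<in> {1..n}" for i \<omega>
    using games_won_eq_score[of \<sigma> l "pos i" "\<lambda>i j. D i j \<omega>"] inj pos[OF that] assms(2,6)
    by (simp add: C_def)
  have C_sets: "{\<omega> \<in> space M. C \<omega> = c} \<in> sets M"
    and C_prob: "prob {\<omega> \<in> space M. C \<omega> = c} = 1 / 2 ^ card (matches l)"
    if "c \<in> Pow (matches l)" for c
    using coins_uniform[of M l p D \<sigma> c] assms that unfolding C_def by auto
  have C_in: "C \<omega> \<in> Pow (matches l)" for \<omega>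
    unfolding C_def by (rule coins_subset)
  have int: "integrable M (\<lambda>\<omega>. f (C \<omega>))" for f :: "(nat \<times> nat) set \<Rightarrow> real"
    by (rule integrable_finite_range[where V = "Pow (matches l)"])
      (use C_sets C_in finite_matches finite_measure_axioms in auto)
  have expect: "expectation (\<lambda>\<omega>. f (C \<omega>)) = avg (Pow (matches l)) f" for f :: "(nat \<times> nat) set \<Rightarrow> real"
  proof -
    have "expectation (\<lambda>\<omega>. f (C \<omega>)) = (\<Sum>c\<in>Pow (matches l). f c * prob {\<omega> \<in> space M. C \<omega> = c})"
      by (rule integral_finite_range)
        (use C_sets C_in finite_matches finite_measure_axioms int in auto)
    also have "\<dots> = (\<Sum>c\<in>Pow (matches l). f c / 2 ^ card (matches l))"
      by (intro sum.cong) (simp_all add: C_prob del: Pow_iff)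
    finally show ?thesis
      by (simp add: avg_def card_Pow finite_matches sum_divide_distrib)
  qed
  have rv: "random_vector M {1..n} S"
    unfolding random_vector_def
  proof (intro conjI ballI)
    fix i assume i: "i \<in> {1..n}"
    have "S i = (\<lambda>\<omega>. score l (C \<omega>) (pos i))" using S[OF i] by auto
    then show "S i \<in> borel_measurable M"
      using int[of "\<lambda>c. score l c (pos i)"] by simp
  qed (auto intro: prob_space_axioms)
  have NA: "negatively_associated M {1..n} S"
    unfolding negatively_associated_def
  proof (intro conjI allI impI rv)
    fix A B and \<phi> \<psi> :: "(nat \<Rightarrow> real) \<Rightarrow> real"
    assume sub: "A \<subseteq> {1..n}" "B \<subseteq> {1..n}" and disj: "A \<inter> B = {}"
      and mono: "mono_on (A \<rightarrow>\<^sub>E UNIV) \<phi>" "mono_on (B \<rightarrow>\<^sub>E UNIV) \<psi>"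
      and ex: "covariance_exists M (\<lambda>\<omega>. \<phi> (\<lambda>i\<in>A. S i \<omega>)) (\<lambda>\<omega>. \<psi> (\<lambda>i\<in>B. S i \<omega>))"
    define f g where "f x = \<phi> (\<lambda>i\<in>A. x (pos i))" and "g x = \<psi> (\<lambda>i\<in>B. x (pos i))" for x
    have \<phi>: "\<phi> (\<lambda>i\<in>A. S i \<omega>) = f (score l (C \<omega>))" for \<omega>
      unfolding f_def using S sub(1) by (intro arg_cong[where f = \<phi>] restrict_ext) auto
    have \<psi>: "\<psi> (\<lambda>i\<in>B. S i \<omega>) = g (score l (C \<omega>))" for \<omega>
      unfolding g_def using S sub(2) by (intro arg_cong[where f = \<psi>] restrict_ext) auto
    have "pos i \<noteq> pos j" if "i \<in> A" "j \<in> B" for i j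
    proof
      assume "pos i = pos j"
      moreover have "i \<in> {1..n}" "j \<in> {1..n}" using that sub by blast+
      ultimately have "i = j" using pos(2)[of i] pos(2)[of j] by metis
      with that disj show False by blast
    qed
    then have "pos ` A \<inter> pos ` B = {}" by blast
    then have "avg (Pow (matches l)) (\<lambda>c. f (score l c) * g (score l c))
        \<le> avg (Pow (matches l)) (\<lambda>c. f (score l c)) * avg (Pow (matches l)) (\<lambda>c. g (score l c))"
      unfolding f_def g_def
      by (rule score_negatively_associated[OF _ mono_in_reindexed_restrict[OF mono(1)]
            mono_in_reindexed_restrict[OF mono(2)]])
    then show "covariance M (\<lambda>\<omega>. \<phi> (\<lambda>i\<in>A. S i \<omega>)) (\<lambda>\<omega>. \<psi> (\<lambda>i\<in>B. S i \<omega>)) \<le> 0"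
      unfolding \<phi> \<psi> covariance_eq[OF prob_space_axioms ex[unfolded \<phi> \<psi>]]
      using expect[of "\<lambda>c. f (score l c) * g (score l c)"] expect[of "\<lambda>c. f (score l c)"]
        expect[of "\<lambda>c. g (score l c)"] by simp
  qed
  moreover have "NSMD M {1..n} S"
  proof (rule negatively_associated_imp_NSMD[OF NA])
    fix i \<omega>
    have "games_won l \<sigma> (\<lambda>i j. D i j \<omega>) i \<le> card (matches l)"
      unfolding games_won_def by (intro card_mono finite_matches) (auto simp: matches_def)
    then show "S i \<omega> \<in> real ` {..card (matches l)}"
      unfolding assms(6) by auto
  qed
  ultimately show ?thesis ..
qed

end
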